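(* Let $q,n,k$ be positive integers with $1\le k\le n$. Let $G_{n,k-1}$ be the subgroup of the symmetric group $S_n$ (acting naturally on $\{1,\dots,n\}$) consisting of the permutations fixing each of $1,2,\dots,k-1$, and let $C_{n,k}=G_{n,k-1}(1,2,\dots,k)$ (a right coset of $G_{n,k-1}$ in $S_n$). Let $\overline{\mathcal{CM}_q}(C_{n,k})$ denote the number of elements of $C_{n,k}$ whose disjoint cycle decomposition contains no cycle of length divisible by $q$. For a nonnegative integer $m$ put $f_q(m)=\prod_{j=1}^{m}\bigl(j-[q\mid j]\bigr)$ (so $f_q(0)=1$), and let $s=q-2-(n \bmod q)$. Then \[ \overline{\mathcal{CM}_q}(C_{n,k})=f_q(n-k+1)-\bigl[(-k)\bmod q\le s\bigr]\,f_q(n-k). \] In particular, $\overline{\mathcal{CM}_q}(S_n)=f_q(n)$.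
   Context: Iverson bracket: for a proposition $P$, $[P]$ equals $1$ if $P$ is true and $0$ otherwise; in particular $[q\mid j]$ is $1$ if $q$ divides $j$ and $0$ otherwise. For an integer $a$, $a \bmod q$ denotes the unique integer $r$ with $a\equiv r\pmod q$ and $0\le r<q$. Permutations are composed so that $G_{n,k-1}(1,2,\dots,k)=\{g\,(1,2,\dots,k): g\in G_{n,k-1}\}$; note $C_{n,1}=S_n$. Cycles in the disjoint cycle decomposition include fixed points as cycles of length $1$. *)

theory Defs
  imports "HOL-Algebra.Sym_Groups"
begin

definition pointwise_stabilizer :: "nat \<Rightarrow> nat \<Rightarrow> (nat \<Rightarrow> nat) set"
  where "pointwise_stabilizer n m = {p \<in> carrier (sym_group n). \<forall>i\<in>{1..m}. p i = i}"

text \<open>Multiplication in \<^const>\<open>sym_group\<close> is \<^term>\<open>(\<circ>)\<close>, so an element \<open>g (1,2,\<dots>,k)\<close> of the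
  coset first applies the cycle \<open>1 \<mapsto> 2 \<mapsto> \<dots> \<mapsto> k \<mapsto> 1\<close> and then \<open>g\<close>.\<close>

definition cycle_coset :: "nat \<Rightarrow> nat \<Rightarrow> (nat \<Rightarrow> nat) set"
  where "cycle_coset n k =
    pointwise_stabilizer n (k - 1) #>\<^bsub>sym_group n\<^esub> cycle_of_list [1..<Suc k]"

text \<open>Since the cycles have to exhaust \<open>A\<close>, every fixed point in \<open>A\<close> occurs as a cycle \<open>[x]\<close>.\<close>

definition disjoint_cycle_decomposition :: "'a set \<Rightarrow> ('a \<Rightarrow> 'a) \<Rightarrow> 'a list list \<Rightarrow> bool"
  where "disjoint_cycle_decomposition A p css \<longleftrightarrow>
    [] \<notin> set css \<and> distinct (concat css) \<and> set (concat css) = A \<and>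
    p = foldr (\<circ>) (map cycle_of_list css) id"

text \<open>The decomposition is unique only up to the order of the cycles and their rotation; the lemmas
  below show that it always exists and that the cycle lengths do not depend on the choice.\<close>

definition no_cycle_length_dvd :: "nat \<Rightarrow> 'a set \<Rightarrow> ('a \<Rightarrow> 'a) \<Rightarrow> bool"
  where "no_cycle_length_dvd q A p \<longleftrightarrow>
    (\<exists>css. disjoint_cycle_decomposition A p css \<and> (\<forall>cs\<in>set css. \<not> q dvd length cs))"

definition CM_bar :: "nat \<Rightarrow> nat \<Rightarrow> (nat \<Rightarrow> nat) set \<Rightarrow> nat"
  where "CM_bar q n C = card {p \<in> C. no_cycle_length_dvd q {1..n} p}"

definition f_cyc :: "nat \<Rightarrow> nat \<Rightarrow> int"
  where "f_cyc q m = (\<Prod>j = 1..m. int j - of_bool (q dvd j))"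

lemma disjoint_cycle_decomposition_exists:
  assumes "p permutes A" "finite A"
  shows "\<exists>css. disjoint_cycle_decomposition A p css"
  using cycle_decomposition[OF assms]
proof (induction rule: cycle_decomp.induct)
  case empty
  have "disjoint_cycle_decomposition {} id []"
    by (simp add: disjoint_cycle_decomposition_def)
  then show ?case by blast
next
  case (comp I p cs)
  then obtain css where css: "disjoint_cycle_decomposition I p css" by blast
  show ?case
  proof (cases "cs = []")
    case True
    then show ?thesis using css by auto
  next
    case False
    then have "disjoint_cycle_decomposition (set cs \<union> I) (cycle_of_list cs \<circ> p) (cs # css)"
      using css comp by (auto simp: disjoint_cycle_decomposition_def)
    then show ?thesis by blast
  qed
qed

lemma foldr_cycle_of_list_outside:
  "x \<notin> set (concat css) \<Longrightarrow> foldr (\<circ>) (map cycle_of_list css) id x = x"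
  by (induction css) (auto simp: id_outside_supp)

lemma cycle_of_list_in_set:
  "x \<in> set cs \<Longrightarrow> cycle_of_list cs x \<in> set cs"
  by (simp add: permutes_in_image[OF cycle_permutes])

lemma foldr_cycle_of_list_inside:
  assumes "distinct (concat css)" "cs \<in> set css" "x \<in> set cs"
  shows "foldr (\<circ>) (map cycle_of_list css) id x = cycle_of_list cs x"
  using assms
proof (induction css)
  case (Cons ds css)
  have disj: "set ds \<inter> set (concat css) = {}" and d: "distinct (concat css)"
    using Cons.prems(1) by auto
  show ?case
  proof (cases "cs \<in> set css")
    case True
    then have "cycle_of_list cs x \<in> set (concat css)"
      using cycle_of_list_in_set[OF Cons.prems(3)] by auto
    then have "cycle_of_list cs x \<notin> set ds" using disj by blast
    then show ?thesis using Cons.IH[OF d True Cons.prems(3)] id_outside_supp[of _ ds]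
      by (simp only: list.map foldr.simps o_apply not_False_eq_True)
  next
    case False
    then have "cs = ds" using Cons.prems(2) by simp
    then have "x \<notin> set (concat css)" using disj Cons.prems(3) by blast
    then have "foldr (\<circ>) (map cycle_of_list css) id x = x" by (rule foldr_cycle_of_list_outside)
    moreover have "foldr (\<circ>) (map cycle_of_list (ds # css)) id x =
        cycle_of_list ds (foldr (\<circ>) (map cycle_of_list css) id x)" by simp
    ultimately show ?thesis using \<open>cs = ds\<close> by (simp only:)
  qed
qed simp

lemma disjoint_cycle_decomposition_length:
  assumes "disjoint_cycle_decomposition A p css" "cs \<in> set css" "x \<in> set cs"
  shows "length cs = least_power p x"
proof -
  have p: "p = foldr (\<circ>) (map cycle_of_list css) id" and dc: "distinct (concat css)"
    using assms(1) by (auto simp: disjoint_cycle_decomposition_def)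
  have d: "distinct cs"
    using dc assms(2) by (simp add: distinct_concat_iff)
  have on_cs: "p y = cycle_of_list cs y" if "y \<in> set cs" for y
    unfolding p by (rule foldr_cycle_of_list_inside[OF dc assms(2) that])
  have pow: "(p ^^ m) x = (cycle_of_list cs ^^ m) x \<and> (p ^^ m) x \<in> set cs" for m
  proof (induction m)
    case 0
    show ?case using assms(3) by simp
  next
    case (Suc m)
    have "p ((p ^^ m) x) = cycle_of_list cs ((p ^^ m) x)" by (rule on_cs[OF conjunct2[OF Suc.IH]])
    moreover have "cycle_of_list cs ((p ^^ m) x) \<in> set cs"
      by (rule cycle_of_list_in_set[OF conjunct2[OF Suc.IH]])
    ultimately show ?case using conjunct1[OF Suc.IH] by (simp only: funpow.simps o_apply)
  qed
  obtain i where i: "i < length cs" "x = cs ! i"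
    using assms(3) by (metis in_set_conv_nth)
  have nth: "(p ^^ m) x = cs ! ((i + m) mod length cs)" for m
  proof -
    have "(p ^^ m) x = map (cycle_of_list cs ^^ m) cs ! i" using pow[of m] i(1) by (simp add: i(2)[symmetric])
    also have "\<dots> = rotate m cs ! i" using cyclic_rotation[OF d] by simp
    also have "\<dots> = cs ! ((i + m) mod length cs)"
      using i(1) by (simp add: nth_rotate add.commute)
    finally show ?thesis .
  qed
  have iff: "(p ^^ m) x = x \<longleftrightarrow> length cs dvd m" for m
  proof -
    have "(p ^^ m) x = x \<longleftrightarrow> (i + m) mod length cs = i"
    proof -
      have "(i + m) mod length cs < length cs"
        using i(1) by (intro mod_less_divisor) linarith
      then have "cs ! ((i + m) mod length cs) = cs ! i \<longleftrightarrow> (i + m) mod length cs = i"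
        using i(1) d by (intro nth_eq_iff_index_eq)
      then show ?thesis by (simp only: nth i(2)[symmetric])
    qed
    also have "\<dots> \<longleftrightarrow> (i + m) mod length cs = i mod length cs" using i(1) by simp
    also have "\<dots> \<longleftrightarrow> length cs dvd m"
      using mod_eq_dvd_iff_nat[of i "i + m" "length cs"] by simp
    finally show ?thesis .
  qed
  have "least_power p x dvd length cs" using iff by (intro least_power_minimal) simp
  moreover have "length cs dvd least_power p x"
  proof -
    have "(p ^^ length cs) x = x" "length cs > 0" using iff[of "length cs"] i(1) by auto
    then show ?thesis by (intro iffD1[OF iff] least_powerI(1))
  qed
  ultimately show ?thesis by (rule dvd_antisym[symmetric])
qed

lemma no_cycle_length_dvd_iff:
  assumes "disjoint_cycle_decomposition A p css"
  shows "no_cycle_length_dvd q A p \<longleftrightarrow> (\<forall>cs\<in>set css. \<not> q dvd length cs)"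
proof -
  have *: "(\<forall>cs\<in>set ds. \<not> q dvd length cs) \<longleftrightarrow> (\<forall>x\<in>A. \<not> q dvd least_power p x)"
    if ds: "disjoint_cycle_decomposition A p ds" for ds
  proof -
    have A: "A = (\<Union>cs\<in>set ds. set cs)" and ne: "[] \<notin> set ds"
      using ds by (auto simp: disjoint_cycle_decomposition_def)
    have "(\<not> q dvd length cs) \<longleftrightarrow> (\<forall>x\<in>set cs. \<not> q dvd least_power p x)" if cs: "cs \<in> set ds" for cs
    proof -
      have "\<exists>x. x \<in> set cs" using ne cs by (cases cs) auto
      moreover have "least_power p x = length cs" if "x \<in> set cs" for x
        by (rule disjoint_cycle_decomposition_length[OF ds cs that, symmetric])
      ultimately show ?thesis by auto
    qed
    then show ?thesis unfolding A by (simp add: ball_UN)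
  qed
  show ?thesis
  proof
    assume "no_cycle_length_dvd q A p"
    then obtain ds where ds: "disjoint_cycle_decomposition A p ds"
      and "\<forall>cs\<in>set ds. \<not> q dvd length cs"
      unfolding no_cycle_length_dvd_def by (elim exE conjE)
    then have "\<forall>x\<in>A. \<not> q dvd least_power p x" by (simp only: *[OF ds])
    then show "\<forall>cs\<in>set css. \<not> q dvd length cs" by (simp only: *[OF assms])
  next
    assume "\<forall>cs\<in>set css. \<not> q dvd length cs"
    with assms show "no_cycle_length_dvd q A p"
      unfolding no_cycle_length_dvd_def by (intro exI conjI)
  qed
qed

end

theory Submission
  imports Defs
begin

text \<open>An element of \<open>C\<^sub>n\<^sub>,\<^sub>k\<close> is a permutation that follows the path \<open>k, 1, 2, \<dots>, k - 1\<close>. Such a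
  permutation either closes its path to a cycle, and then the rest is an arbitrary permutation of the
  remaining points, or it extends the path by one of these points. This gives a recursion in
  the number \<open>m = n - k\<close> of points off the path, along which \<open>n\<close> does not change, and the formula
  satisfies the same recursion.\<close>

section \<open>Permutations following a path: closing it or extending it\<close>

definition permutations_along :: "'a set \<Rightarrow> 'a list \<Rightarrow> ('a \<Rightarrow> 'a) set"
  where "permutations_along A xs = {p. p permutes A \<and> successively (\<lambda>x y. p x = y) xs}"

lemma successively_graph_iff:
  "xs \<noteq> [] \<Longrightarrow> successively (\<lambda>x y. p x = y) xs \<longleftrightarrow> map p xs = tl xs @ [p (last xs)]"
proof (induction xs rule: induct_list012)
  case (3 x y zs)
  then show ?case by auto
qed auto

text \<open>Since \<open>cycle_of_list xs\<close> maps \<open>xs\<close> to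
  \<open>rotate1 xs\<close>, the left side says that \<open>p\<close> agrees with this cycle on
  \<open>xs\<close>; this is the form in which a closed path is used below.\<close>

lemma map_eq_rotate1_iff:
  assumes "xs \<noteq> []"
  shows "map p xs = rotate1 xs \<longleftrightarrow> successively (\<lambda>x y. p x = y) xs \<and> p (last xs) = hd xs"
proof -
  have "map p xs = butlast (map p xs) @ [p (last xs)]"
    using assms by (metis append_butlast_last_id last_map list.map_disc_iff)
  moreover have "rotate1 xs = tl xs @ [hd xs]"
    using assms by (cases xs) auto
  ultimately show ?thesis
    unfolding successively_graph_iff[OF assms] by (metis append1_eq_conv)
qed

lemma successively_snoc_iff:
  "xs \<noteq> [] \<Longrightarrow> successively P (xs @ [y]) \<longleftrightarrow> successively P xs \<and> P (last xs) y"
  by (auto simp: successively_append_iff)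

lemma map_cycle_of_list: "distinct xs \<Longrightarrow> map (cycle_of_list xs) xs = rotate1 xs"
  using cyclic_rotation[of xs 1] by simp

text \<open>Every entry except the head is already the image of its predecessor, so by injectivity
  only the head is left as an image of the last entry inside the path.\<close>

lemma permutation_path_closes:
  assumes p: "inj p" and xs: "distinct xs" "xs \<noteq> []" "successively (\<lambda>x y. p x = y) xs"
    and last: "p (last xs) \<in> set xs"
  shows "p (last xs) = hd xs"
proof (rule ccontr)
  assume "p (last xs) \<noteq> hd xs"
  with last xs(2) have "p (last xs) \<in> set (tl xs)" by (cases xs) auto
  moreover have "map p xs = tl xs @ [p (last xs)]"
    using xs by (simp add: successively_graph_iff)
  ultimately have "\<not> distinct (map p xs)" by simp
  moreover have "distinct (map p xs)"
    using xs(1) inj_on_subset[OF p subset_UNIV] by (simp add: distinct_map)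
  ultimately show False ..
qed

lemma permutations_closing:
  assumes xs: "distinct xs" "xs \<noteq> []" "set xs \<subseteq> A"
  shows "{p \<in> permutations_along A xs. p (last xs) = hd xs} =
    (\<circ>) (cycle_of_list xs) ` {p. p permutes (A - set xs)}"
proof (intro equalityI subsetI)
  let ?c = "cycle_of_list xs"
  have c: "?c permutes A" using cycle_permutes permutes_subset xs(3) by blast
  fix p assume "p \<in> {p \<in> permutations_along A xs. p (last xs) = hd xs}"
  then have p: "p permutes A" and "map p xs = rotate1 xs"
    using map_eq_rotate1_iff[OF xs(2)] by (auto simp: permutations_along_def)
  then have eq: "p x = ?c x" if "x \<in> set xs" for x
    using map_cycle_of_list[OF xs(1)] that by (metis map_eq_conv)
  have "inv' ?c \<circ> p permutes A"
    using p c by (intro permutes_compose permutes_inv)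
  \<comment> \<open>Dividing off the cycle leaves every point of \<open>xs\<close> fixed, because
    \<open>p\<close> and \<open>?c\<close> agree there; hence the quotient moves points off the path
    only.\<close>
  then have "inv' ?c \<circ> p permutes (A - set xs)"
    by (rule permutes_superset) (use eq in \<open>auto simp: permutes_inverses[OF c]\<close>)
  moreover have "p = ?c \<circ> (inv' ?c \<circ> p)"
    by (auto simp: fun_eq_iff permutes_inverses[OF c])
  ultimately show "p \<in> (\<circ>) ?c ` {p. p permutes (A - set xs)}" by blast
next
  let ?c = "cycle_of_list xs"
  have c: "?c permutes A" using cycle_permutes permutes_subset xs(3) by blast
  fix p assume "p \<in> (\<circ>) ?c ` {p. p permutes (A - set xs)}"
  then obtain g where g: "g permutes (A - set xs)" and p: "p = ?c \<circ> g" by blast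
  have "p permutes A"
    unfolding p using c g by (meson permutes_compose permutes_subset Diff_subset)
  moreover have "map p xs = rotate1 xs"
    unfolding map_cycle_of_list[OF xs(1), symmetric] p
    using g by (auto simp: permutes_not_in)
  ultimately show "p \<in> {p \<in> permutations_along A xs. p (last xs) = hd xs}"
    using map_eq_rotate1_iff[OF xs(2)] by (auto simp: permutations_along_def)
qed

lemma permutations_along_split:
  assumes xs: "distinct xs" "xs \<noteq> []" "set xs \<subseteq> A"
  shows "permutations_along A xs =
    (\<circ>) (cycle_of_list xs) ` {p. p permutes (A - set xs)} \<union>
    (\<Union>y\<in>A - set xs. permutations_along A (xs @ [y]))"
proof -
  have "p (last xs) = hd xs \<or> p (last xs) \<in> A - set xs" if "p \<in> permutations_along A xs" for p
  proof (cases "p (last xs) \<in> set xs")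
    case True
    then show ?thesis
      using that xs permutation_path_closes[of p xs]
      by (auto simp: permutations_along_def permutes_inj)
  next
    case False
    have "last xs \<in> A" using xs by auto
    then show ?thesis
      using False that by (auto simp: permutations_along_def permutes_in_image)
  qed
  then show ?thesis
    unfolding permutations_closing[OF xs, symmetric]
    using xs(2) by (auto simp: permutations_along_def successively_snoc_iff)
qed

text \<open>Putting \<open>xs\<close> in front of a decomposition of \<open>p\<close> decomposes the
  composite, and \<open>no_cycle_length_dvd_iff\<close> allows the lengths to be tested on any one
  decomposition.\<close>

lemma no_cycle_length_dvd_cycle_comp:
  assumes xs: "distinct xs" "xs \<noteq> []" "set xs \<subseteq> A" and "finite A"
    and p: "p permutes (A - set xs)"
  shows "no_cycle_length_dvd q A (cycle_of_list xs \<circ> p) \<longleftrightarrow>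
    \<not> q dvd length xs \<and> no_cycle_length_dvd q (A - set xs) p"
proof -
  obtain css where css: "disjoint_cycle_decomposition (A - set xs) p css"
    using disjoint_cycle_decomposition_exists[OF p] \<open>finite A\<close> by blast
  then have "disjoint_cycle_decomposition A (cycle_of_list xs \<circ> p) (xs # css)"
    using xs by (auto simp: disjoint_cycle_decomposition_def)
  from no_cycle_length_dvd_iff[OF this] no_cycle_length_dvd_iff[OF css]
  show ?thesis by simp
qed

section \<open>Recursion for the number of permutations along a path\<close>

definition count_along :: "nat \<Rightarrow> 'a set \<Rightarrow> 'a list \<Rightarrow> nat"
  where "count_along q A xs = card {p \<in> permutations_along A xs. no_cycle_length_dvd q A p}"

definition count_all :: "nat \<Rightarrow> 'a set \<Rightarrow> nat"
  where "count_all q A = card {p. p permutes A \<and> no_cycle_length_dvd q A p}"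

lemma count_along_rec:
  assumes xs: "distinct xs" "xs \<noteq> []" "set xs \<subseteq> A" and A: "finite A"
  shows "count_along q A xs = of_bool (\<not> q dvd length xs) * count_all q (A - set xs) +
    (\<Sum>y\<in>A - set xs. count_along q A (xs @ [y]))"
proof -
  let ?c = "cycle_of_list xs"
  let ?C = "{p \<in> (\<circ>) ?c ` {p. p permutes (A - set xs)}. no_cycle_length_dvd q A p}"
  let ?E = "\<lambda>y. {p \<in> permutations_along A (xs @ [y]). no_cycle_length_dvd q A p}"
  have fin: "finite (permutations_along A ys)" for ys :: "'a list"
    using finite_permutations[OF A] by (rule rev_finite_subset) (auto simp: permutations_along_def)
  \<comment> \<open>The value \<open>p (last xs)\<close> tells the pieces apart: it is
    \<open>y\<close> on \<open>?E y\<close> and \<open>hd xs\<close>, a point of the path, on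
    \<open>?C\<close>. So all the unions below are disjoint.\<close>
  have lastE: "p (last xs) = y" if "p \<in> ?E y" for p y
    using that xs(2) by (simp add: permutations_along_def successively_snoc_iff)
  have closing: "?C \<subseteq> {p \<in> permutations_along A xs. p (last xs) = hd xs}"
    unfolding permutations_closing[OF xs] by blast
  have lastC: "p (last xs) = hd xs" if "p \<in> ?C" for p
    using subsetD[OF closing that] by simp
  have "hd xs \<in> set xs" using xs(2) by simp
  have "{p \<in> permutations_along A xs. no_cycle_length_dvd q A p} = ?C \<union> (\<Union>y\<in>A - set xs. ?E y)"
    unfolding permutations_along_split[OF xs] by (auto simp only:)
  also have "card \<dots> = card ?C + card (\<Union>y\<in>A - set xs. ?E y)"
  proof (rule card_Un_disjoint)
    show "finite ?C"
      using finite_permutations[of "A - set xs"] A by auto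
    show "finite (\<Union>y\<in>A - set xs. ?E y)"
      using A fin by auto
    show "?C \<inter> (\<Union>y\<in>A - set xs. ?E y) = {}"
    proof (intro equals0I)
      fix p assume "p \<in> ?C \<inter> (\<Union>y\<in>A - set xs. ?E y)"
      then obtain y where p: "p \<in> ?C" "p \<in> ?E y" and "y \<notin> set xs" by (elim IntE UN_E DiffE)
      then show False using lastC[OF p(1)] lastE[OF p(2)] \<open>hd xs \<in> set xs\<close> by simp
    qed
  qed
  also have "card (\<Union>y\<in>A - set xs. ?E y) = (\<Sum>y\<in>A - set xs. count_along q A (xs @ [y]))"
    unfolding count_along_def
  proof (rule card_UN_disjoint)
    show "\<forall>y\<in>A - set xs. finite (?E y)" using fin by auto
    show "\<forall>y\<in>A - set xs. \<forall>z\<in>A - set xs. y \<noteq> z \<longrightarrow> ?E y \<inter> ?E z = {}"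
    proof (intro ballI impI equals0I)
      fix y z p assume "y \<noteq> z" and p: "p \<in> ?E y \<inter> ?E z"
      then show False using lastE[OF IntD1[OF p]] lastE[OF IntD2[OF p]] by simp
    qed
  qed (use A in auto)
  also have "card ?C = of_bool (\<not> q dvd length xs) * count_all q (A - set xs)"
  proof -
    have C: "?C = (\<circ>) ?c ` {p. p permutes (A - set xs) \<and> \<not> q dvd length xs \<and>
        no_cycle_length_dvd q (A - set xs) p}"
      using no_cycle_length_dvd_cycle_comp[OF xs A] by blast
    have "inj ((\<circ>) ?c :: ('a \<Rightarrow> 'a) \<Rightarrow> _)"
      using permutes_inj[OF cycle_permutes] by (rule fun.inj_map)
    then have "card ((\<circ>) ?c ` X) = card X" for X :: "('a \<Rightarrow> 'a) set"
      by (rule card_image[OF inj_on_subset[OF _ subset_UNIV]])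
    then show ?thesis
      by (simp only: C count_all_def) (cases "q dvd length xs"; simp)
  qed
  finally show ?thesis unfolding count_along_def .
qed

text \<open>A path of one point imposes no condition, so unrestricted counts fall under the same
  recursion.\<close>

lemma count_all_conv_count_along: "count_all q A = count_along q A [x]"
  by (simp add: count_all_def count_along_def permutations_along_def)

lemma count_all_empty [simp]: "count_all q {} = 1"
proof -
  have "no_cycle_length_dvd q {} (id :: 'a \<Rightarrow> 'a)"
    unfolding no_cycle_length_dvd_def disjoint_cycle_decomposition_def
    by (intro exI[of _ "[]"]) auto
  then have "{p :: 'a \<Rightarrow> 'a. p permutes {} \<and> no_cycle_length_dvd q {} p} = {id}" by auto
  then show ?thesis by (simp add: count_all_def)
qed

section \<open>The closed formula satisfies the same recursion\<close>

definition path_count :: "nat \<Rightarrow> nat \<Rightarrow> nat \<Rightarrow> int"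
  where "path_count q m k = f_cyc q (m + 1) -
    of_bool ((- int k) mod int q \<le> int q - 2 - int ((m + k) mod q)) * f_cyc q m"

lemma f_cyc_0 [simp]: "f_cyc q 0 = 1"
  by (simp add: f_cyc_def)

lemma f_cyc_Suc: "f_cyc q (Suc m) = (int (Suc m) - of_bool (q dvd Suc m)) * f_cyc q m"
  by (simp add: f_cyc_def)

text \<open>Together with \<open>add_mod_cases\<close> this turns the bracket in
  \<open>path_count\<close> into linear inequalities between residues, which case splitting can
  settle.\<close>

lemma neg_mod_int:
  "(- int k) mod int q = (if k mod q = 0 then 0 else int q - int (k mod q))"
  by (simp add: zmod_zminus1_eq_if flip: zmod_int)

lemma add_mod_cases:
  assumes "q \<ge> (1::nat)"
  shows "(m + k) mod q = (if m mod q + k mod q < q then m mod q + k mod q else m mod q + k mod q - q)"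
proof -
  have "(a + b) mod q = (if a + b < q then a + b else a + b - q)" if "a < q" "b < q" for a b
    using that by (simp add: le_mod_geq)
  from this[of "m mod q" "k mod q"] show ?thesis
    using assms by (simp add: mod_add_eq)
qed

lemma path_count_1:
  assumes "q \<ge> 1"
  shows "path_count q m 1 = f_cyc q (Suc m)"
proof -
  \<comment> \<open>The residue of -1 is \<open>q - 1\<close>, also for \<open>q = 1\<close>, and
    this exceeds \<open>q - 2\<close>.\<close>
  have "\<not> (- int 1) mod int q \<le> int q - 2 - int ((m + 1) mod q)"
    using assms by (cases "q = 1") (auto simp: zmod_minus1)
  then show ?thesis unfolding path_count_def by (simp del: of_nat_1 of_nat_Suc)
qed

lemma path_count_0:
  assumes "q \<ge> 1"
  shows "path_count q 0 k = of_bool (\<not> q dvd k)"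
  \<comment> \<open>For \<open>q = 1\<close> both \<open>f_cyc q 1\<close> and the bracket are 0.
    For larger \<open>q\<close>, \<open>f_cyc q 1\<close> is 1 and the bracket holds exactly when
    \<open>q\<close> divides \<open>k\<close>.\<close>
  using assms by (cases "q = 1") (auto simp: path_count_def neg_mod_int f_cyc_Suc dvd_eq_mod_eq_0)

lemma path_count_Suc:
  assumes q: "q \<ge> 1"
  shows "path_count q (Suc m) k =
    of_bool (\<not> q dvd k) * f_cyc q (Suc m) + int (Suc m) * path_count q m (Suc k)"
proof -
  \<comment> \<open>As \<open>Suc m + k = m + Suc k\<close>, the brackets on the two sides of the
    recursion are \<open>c k\<close> and \<open>c (Suc k)\<close>, with the same total
    inside.\<close>
  define c :: "nat \<Rightarrow> bool"
    where "c j \<longleftrightarrow> (- int j) mod int q \<le> int q - 2 - int ((Suc m + k) mod q)" for j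
  define r t where "r = k mod q" and "t = Suc m mod q"
  have less: "r < q" "t < q" using q by (auto simp: r_def t_def)
  note mods = c_def neg_mod_int add_mod_cases[OF q, of "Suc m" k] dvd_eq_mod_eq_0
    mod_Suc[of k] mod_Suc[of "Suc m"] r_def[symmetric] t_def[symmetric]
  \<comment> \<open>\<open>c (Suc k)\<close> amounts to a carry, \<open>r + t \<ge> q\<close>, while
    \<open>c k\<close> amounts to \<open>t \<noteq> q - 1\<close> together with \<open>r = 0\<close>
    or a carry. Moreover \<open>q dvd Suc (Suc m)\<close> means \<open>t = q - 1\<close>. The
    identity follows by cases on \<open>t = q - 1\<close> and \<open>r = 0\<close>.\<close>
  have c_rec: "of_bool (q dvd Suc (Suc m)) + of_bool (c k) + of_bool (\<not> q dvd k) =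
      (1 :: int) + of_bool (c (Suc k))"
    unfolding mods using less by (auto split: if_splits)
  \<comment> \<open>A carry is impossible for \<open>t = 0\<close>. So where the bracket is 1, the
    last factor of \<open>f_cyc q (Suc m)\<close> is exactly \<open>Suc m\<close>.\<close>
  have c_dvd: "\<not> q dvd Suc m" if "c (Suc k)"
    using that less unfolding mods by (auto split: if_splits)
  have "path_count q (Suc m) k =
      (int (Suc (Suc m)) - of_bool (q dvd Suc (Suc m)) - of_bool (c k)) * f_cyc q (Suc m)"
    by (simp add: path_count_def c_def f_cyc_Suc[of q "Suc m"] left_diff_distrib)
  also have "\<dots> = (int (Suc m) + of_bool (\<not> q dvd k) - of_bool (c (Suc k))) * f_cyc q (Suc m)"
    using c_rec by (intro arg_cong2[where f = "(*)"]) auto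
  also have "\<dots> = of_bool (\<not> q dvd k) * f_cyc q (Suc m) + int (Suc m) * f_cyc q (Suc m) -
      of_bool (c (Suc k)) * f_cyc q (Suc m)"
    by (simp add: algebra_simps)
  also have "of_bool (c (Suc k)) * f_cyc q (Suc m) =
      of_bool (c (Suc k)) * (int (Suc m) * f_cyc q m)"
    using c_dvd by (auto simp: f_cyc_Suc)
  finally show ?thesis
    by (simp add: path_count_def c_def algebra_simps)
qed

lemma count_along_eq:
  assumes "q \<ge> 1" "finite A" "distinct xs" "xs \<noteq> []" "set xs \<subseteq> A"
  shows "int (count_along q A xs) = path_count q (card (A - set xs)) (length xs)"
  using assms(2-)
\<comment> \<open>Not only \<open>xs\<close> but also \<open>A\<close> has to vary, because closing
  the path leaves a count over the smaller set \<open>A - set xs\<close>.\<close>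
proof (induction "card (A - set xs)" arbitrary: A xs rule: less_induct)
  case less
  note A = less.prems(1) and xs = less.prems(2-4)
  have all: "int (count_all q (A - set xs)) = f_cyc q (card (A - set xs))"
  proof (cases "A - set xs = {}")
    case False
    \<comment> \<open>Seen as a path \<open>[x]\<close> inside \<open>A - set xs\<close>, the
      unrestricted count has one point fewer off its path, so the induction hypothesis
      applies.\<close>
    then obtain x where x: "x \<in> A - set xs" by blast
    define B where "B = A - set xs - set [x]"
    have "card (A - set xs) = Suc (card B)"
      using x A unfolding B_def by (metis card.remove empty_set finite_Diff list.simps(15))
    moreover from this have "int (count_along q (A - set xs) [x]) = path_count q (card B) 1"
      using less.hyps[of "A - set xs" "[x]", folded B_def] x A by simp
    ultimately show ?thesis
      using path_count_1[OF assms(1)] by (simp add: count_all_conv_count_along[of q _ x])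
  qed (simp only: count_all_empty, simp)
  have step: "int (count_along q A (xs @ [y])) =
      path_count q (card (A - set xs) - 1) (Suc (length xs))"
    if y: "y \<in> A - set xs" for y
  proof -
    have "A - set (xs @ [y]) = A - set xs - {y}" by auto
    then have card: "card (A - set (xs @ [y])) = card (A - set xs) - 1" "card (A - set xs) > 0"
      using y A by (auto simp: card_gt_0_iff)
    then have "card (A - set (xs @ [y])) < card (A - set xs)" by simp
    from less.hyps[OF this A] show ?thesis using y xs card by simp
  qed
  show ?case
  proof (cases "card (A - set xs)")
    case 0
    then have "A - set xs = {}" using A by (simp only: finite_Diff card_0_eq)
    then show ?thesis
      using count_along_rec[OF xs A, of q] all path_count_0[OF assms(1)]
      by (simp only: sum.empty card.empty) simp
  next
    case (Suc m)
    have "int (count_along q A xs) = of_bool (\<not> q dvd length xs) * f_cyc q (Suc m) +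
        (\<Sum>y\<in>A - set xs. int (count_along q A (xs @ [y])))"
      using count_along_rec[OF xs A, of q] all Suc by simp
    also have "(\<Sum>y\<in>A - set xs. int (count_along q A (xs @ [y]))) =
        int (Suc m) * path_count q m (Suc (length xs))"
      using step Suc by simp
    finally show ?thesis
      by (simp only: Suc path_count_Suc[OF assms(1)])
  qed
qed

lemma count_all_eq:
  assumes "q \<ge> 1" "finite A"
  shows "int (count_all q A) = f_cyc q (card A)"
proof (cases "A = {}")
  case False
  then obtain x where "x \<in> A" by blast
  moreover from this have "card A = Suc (card (A - {x}))"
    by (rule card.remove[OF assms(2)])
  ultimately show ?thesis
    using count_along_eq[OF assms, of "[x]"] path_count_1[OF assms(1)]
    by (simp add: count_all_conv_count_along[of q A x])
qed simp

section \<open>The coset as the set of permutations along a path\<close>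

lemma cycle_coset_conv:
  assumes k: "1 \<le> k" "k \<le> n"
  shows "cycle_coset n k = permutations_along {1..n} (k # [1..<k])"
proof -
  let ?c = "cycle_of_list [1..<Suc k]"
  have "set [1..<Suc k] \<subseteq> {1..n}" using k by auto
  then have c: "?c permutes {1..n}" using cycle_permutes permutes_subset by blast
  have "rotate1 [1..<Suc k] = [2..<Suc k] @ [1]"
    using k by (simp add: upt_conv_Cons numeral_2_eq_2)
  then have eq: "map ?c [1..<Suc k] = [2..<Suc k] @ [1]"
    by (simp only: map_cycle_of_list distinct_upt)
  have c_lt: "?c i = Suc i" if "1 \<le> i" "i < k" for i
    using arg_cong[OF eq, of "\<lambda>xs. xs ! (i - 1)"] that by (simp add: nth_append del: upt_Suc)
  have c_k: "?c k = 1"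
    using arg_cong[OF eq, of last] k by simp
  \<comment> \<open>The cycle \<open>?c\<close> sends the path \<open>k, 1, ..., k - 1\<close> entry
    by entry to \<open>1, 2, ..., k\<close>. Following the path therefore means that
    \<open>g\<close> fixes \<open>1, ..., k - 1\<close>; the image \<open>g k\<close> of the last
    entry stays free.\<close>
  have path: "successively (\<lambda>x y. (g \<circ> ?c) x = y) (k # [1..<k]) \<longleftrightarrow> (\<forall>i\<in>{1..k - 1}. g i = i)"
    (is "?L \<longleftrightarrow> ?R") for g
  proof -
    have "?L \<longleftrightarrow> (\<forall>i. Suc i < k \<longrightarrow> g (Suc i) = Suc i)"
    proof -
      have "(g \<circ> ?c) ((k # [1..<k]) ! i) = (k # [1..<k]) ! Suc i \<longleftrightarrow> g (Suc i) = Suc i"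
        if "Suc i < k" for i
        using that c_lt[of i] c_k by (cases i) (auto simp del: upt_Suc)
      then show ?thesis
        using k(1) by (simp add: successively_conv_nth del: upt_Suc)
    qed
    also have "\<dots> \<longleftrightarrow> ?R"
    proof -
      have "{1..k - 1} = Suc ` {..<k - 1}"
        by (metis One_nat_def atLeastAtMost_singleton image_Suc_lessThan)
      then show ?thesis by auto
    qed
    finally show ?thesis .
  qed
  have "p \<in> cycle_coset n k \<longleftrightarrow>
      (\<exists>g. g permutes {1..n} \<and> (\<forall>i\<in>{1..k - 1}. g i = i) \<and> p = g \<circ> ?c)" for p
    by (auto simp: cycle_coset_def pointwise_stabilizer_def r_coset_def sym_group_def)
  moreover have "(\<exists>g. g permutes {1..n} \<and> (\<forall>i\<in>{1..k - 1}. g i = i) \<and> p = g \<circ> ?c) \<longleftrightarrow>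
      p \<in> permutations_along {1..n} (k # [1..<k])" for p
  proof
    assume "p \<in> permutations_along {1..n} (k # [1..<k])"
    moreover have "p = (p \<circ> inv' ?c) \<circ> ?c"
      by (simp only: comp_assoc permutes_inv_o(2)[OF c] comp_id)
    ultimately show "\<exists>g. g permutes {1..n} \<and> (\<forall>i\<in>{1..k - 1}. g i = i) \<and> p = g \<circ> ?c"
      using permutes_compose[OF permutes_inv[OF c], of p] path[of "p \<circ> inv' ?c"]
      by (intro exI[of _ "p \<circ> inv' ?c"]) (simp add: permutations_along_def)
  next
    assume "\<exists>g. g permutes {1..n} \<and> (\<forall>i\<in>{1..k - 1}. g i = i) \<and> p = g \<circ> ?c"
    then show "p \<in> permutations_along {1..n} (k # [1..<k])"
      using c path by (auto simp: permutations_along_def intro: permutes_compose)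
  qed
  ultimately show ?thesis by blast
qed

theorem theorem2p2:
  fixes q n k :: nat and s :: int
  assumes "q \<ge> 1" and "n \<ge> 1" and "1 \<le> k" and "k \<le> n"
    and "s = int q - 2 - int (n mod q)"
  shows "int (CM_bar q n (cycle_coset n k)) =
           f_cyc q (n - k + 1) - of_bool ((- int k) mod int q \<le> s) * f_cyc q (n - k)
         \<and> int (CM_bar q n (carrier (sym_group n))) = f_cyc q n"
proof
  have "set (k # [1..<k]) = {1..k}" using assms(3) by auto
  then have sub: "set (k # [1..<k]) \<subseteq> {1..n}"
    and card: "card ({1..n} - set (k # [1..<k])) = n - k"
    using assms(3,4) by (auto simp: card_Diff_subset)
  have "CM_bar q n (cycle_coset n k) = count_along q {1..n} (k # [1..<k])"
    using assms(3,4) by (simp add: CM_bar_def cycle_coset_conv count_along_def)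
  also have "int \<dots> = path_count q (n - k) k"
    using count_along_eq[OF assms(1) _ _ _ sub] card assms(3) by simp
  finally show "int (CM_bar q n (cycle_coset n k)) =
      f_cyc q (n - k + 1) - of_bool ((- int k) mod int q \<le> s) * f_cyc q (n - k)"
    using assms(4,5) by (simp add: path_count_def)
  show "int (CM_bar q n (carrier (sym_group n))) = f_cyc q n"
    using count_all_eq[OF assms(1), of "{1..n}"]
    by (simp add: CM_bar_def count_all_def sym_group_carrier)
qed

end
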